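(* Let $f$ be the sum of an arbitrary number, $K$, of sinusoidal signals in $N$ dimensions, with differing amplitudes, phases and directions of oscillation, but the same angular frequency $\omega$: $$f(t)=\sum_{i=1}^{K}\boldsymbol{n}_i\sin(\omega t+\phi_i),$$ and let $$\boldsymbol{c}=\sum_{i=1}^{K}\boldsymbol{n}_i\cos\phi_i,\qquad \boldsymbol{s}=\sum_{i=1}^{K}\boldsymbol{n}_i\sin\phi_i,$$ so that $f(t)=\boldsymbol{c}\sin(\omega t)+\boldsymbol{s}\cos(\omega t)$. Then $f$ may be expressed in terms of the major and minor axes of the ellipse that it traces as $$f(t)=\boldsymbol{a}\sin(\omega t+\psi)+\boldsymbol{b}\cos(\omega t+\psi),$$ where $\boldsymbol{a}$ and $\boldsymbol{b}$ are orthogonal vectors defining the major and minor axes of the ellipse respectively (that is, $\boldsymbol{a}\perp\boldsymbol{b}$ and $\|\boldsymbol{a}\|-\|\boldsymbol{b}\|\ge 0$), and $\psi$ is a phase. The vectors $\boldsymbol{a}$ and $\boldsymbol{b}$ are given by $$\boldsymbol{a}=\boldsymbol{c}\cos\psi+\boldsymbol{s}\sin\psi,\qquad \boldsymbol{b}=-\boldsymbol{c}\sin\psi+\boldsymbol{s}\cos\psi,$$ and $\psi$ is given by $$\frac12\tan 2\psi=\frac{\langle\boldsymbol{c},\boldsymbol{s}\rangle}{\|\boldsymbol{c}\|-\|\boldsymbol{s}\|}.$$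
   Context: Here $N>1$, each $\boldsymbol{n}_i$ is a vector in $\mathbb{R}^N$ (not necessarily a unit vector) giving the direction and amplitude of oscillation of the $i$-th signal, $\phi_i\in\mathbb{R}$ is its initial phase at $t=0$, and $\omega\in\mathbb{R}$ is the common angular frequency. $\langle\boldsymbol{u},\boldsymbol{v}\rangle$ is the Euclidean inner product on $\mathbb{R}^N$. Non-standard notation: the norm $\|\boldsymbol{u}\|$ denotes the square of the Euclidean length of $\boldsymbol{u}$, i.e. $\|\boldsymbol{u}\|=\langle\boldsymbol{u},\boldsymbol{u}\rangle$. The ellipse is the path traced by the values $f(t)$ in $\mathbb{R}^N$, which lies in a plane because $f(t)=\boldsymbol{c}\sin(\omega t)+\boldsymbol{s}\cos(\omega t)$. *)

theory Defs
  imports "HOL-Analysis.Analysis"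
begin

text \<open>The squared Euclidean length (not the length itself).\<close>

definition sqnorm :: "real ^ 'n \<Rightarrow> real" where
  "sqnorm u = u \<bullet> u"

text \<open>The ellipse centred at the origin with semi-axes \<open>a\<close> and \<open>b\<close>, meant for
  orthogonal \<open>a\<close> and \<open>b\<close>.  It degenerates to a segment or a point if one or both of them vanish.\<close>

definition ellipse :: "real ^ 'n \<Rightarrow> real ^ 'n \<Rightarrow> (real ^ 'n) set" where
  "ellipse a b = {x *\<^sub>R a + y *\<^sub>R b | x y. x\<^sup>2 + y\<^sup>2 = 1}"

text \<open>The signal \<open>f\<close> is expressed, with phase \<open>\<psi>\<close>, through the major axis \<open>a\<close> and the minor
  axis \<open>b\<close> of the curve it traces.  For \<open>\<omega> = 0\<close> the signal is constant and traces no
  ellipse, hence the guard in the last clause.\<close>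

definition axis_form ::
  "real \<Rightarrow> (real \<Rightarrow> real ^ 'n) \<Rightarrow> real ^ 'n \<Rightarrow> real ^ 'n \<Rightarrow> real \<Rightarrow> bool" where
  "axis_form \<omega> f a b \<psi> \<longleftrightarrow>
     (\<forall>t. f t = sin (\<omega> * t + \<psi>) *\<^sub>R a + cos (\<omega> * t + \<psi>) *\<^sub>R b) \<and>
     orthogonal a b \<and> sqnorm a - sqnorm b \<ge> 0 \<and>
     (\<omega> \<noteq> 0 \<longrightarrow> range f = ellipse a b)"

text \<open>The equation \<open>tan (2\<psi>) / 2 = \<langle>c, s\<rangle> / (\<parallel>c\<parallel> - \<parallel>s\<parallel>)\<close>, read without the
  conventions \<open>x / 0 = 0\<close> and \<open>tan (\<pi>/2) = 0\<close>: if only the denominator vanishes, both sides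
  are infinite, that is \<open>cos (2\<psi>) = 0\<close>; if the right-hand side is 0/0 (the curve is a circle
  or a point), \<open>\<psi>\<close> is unconstrained.\<close>

definition axis_phase :: "real ^ 'n \<Rightarrow> real ^ 'n \<Rightarrow> real \<Rightarrow> bool" where
  "axis_phase c s \<psi> \<longleftrightarrow>
     (if sqnorm c \<noteq> sqnorm s
      then cos (2 * \<psi>) \<noteq> 0 \<and> 1 / 2 * tan (2 * \<psi>) = (c \<bullet> s) / (sqnorm c - sqnorm s)
      else c \<bullet> s \<noteq> 0 \<longrightarrow> cos (2 * \<psi>) = 0)"

end

theory Submission
  imports Defs
begin

text \<open>
  By the addition theorem, the sinusoids collapse to \<open>f t = sin (\<omega> t) c + cos (\<omega> t) s\<close>. Shifting the
  phase by \<open>\<psi>\<close> amounts to rotating the pair \<open>(c, s)\<close> to \<open>(a, b)\<close>, where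
  \<open>a = cos \<psi> c + sin \<psi> s\<close> and \<open>b = - sin \<psi> c + cos \<psi> s\<close>. Under this rotation the pair of
  quadratic quantities \<open>(\<parallel>c\<parallel> - \<parallel>s\<parallel>, 2 \<langle>c, s\<rangle>)\<close> turns by the angle \<open>-2\<psi>\<close>
  (\<open>inner_phase_rotated\<close>, \<open>sqnorm_diff_phase_rotated\<close>). The axes are orthogonal with \<open>a\<close> the major
  one exactly if the turned pair lies on the nonnegative first coordinate axis, so \<open>2\<psi>\<close> may be
  taken as a polar angle of the pair (\<open>exists_polar_half_angle\<close>). The
  quotient of its coordinates gives \<open>tan (2\<psi>)\<close>, with \<open>cos (2\<psi>) = 0\<close> if only the first one
  vanishes; both vanish exactly for a circle or a point.

  Conversely, for \<open>\<omega> \<noteq> 0\<close> the argument \<open>\<omega> t + \<psi>\<close> takes every value. Evaluating an axis form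
  where it equals \<open>\<pi>/2\<close> and \<open>0\<close> recovers \<open>a\<close> and \<open>b\<close> as the rotated pair, and their orthogonality
  alone forces the equation for \<open>\<psi>\<close> (\<open>axis_phase_if_orthogonal\<close>).
\<close>

lemma sum_sinusoids:
  fixes n :: "'i \<Rightarrow> 'a::real_vector"
  shows "(\<Sum>i\<in>I. sin (\<theta> + \<phi> i) *\<^sub>R n i) =
    sin \<theta> *\<^sub>R (\<Sum>i\<in>I. cos (\<phi> i) *\<^sub>R n i) + cos \<theta> *\<^sub>R (\<Sum>i\<in>I. sin (\<phi> i) *\<^sub>R n i)"
  by (simp add: sin_add scaleR_add_left sum.distrib scaleR_sum_right)

text \<open>The shift of the argument and the rotation of the coefficient vectors are inverse rotations
  of the plane, so they cancel.\<close>

lemma sinusoid_phase_shift: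
  fixes c s :: "'a::real_vector"
  shows "sin (\<theta> + \<psi>) *\<^sub>R (cos \<psi> *\<^sub>R c + sin \<psi> *\<^sub>R s) +
    cos (\<theta> + \<psi>) *\<^sub>R (- (sin \<psi> *\<^sub>R c) + cos \<psi> *\<^sub>R s) = sin \<theta> *\<^sub>R c + cos \<theta> *\<^sub>R s"
proof -
  have "sin (\<theta> + \<psi>) * cos \<psi> - cos (\<theta> + \<psi>) * sin \<psi> = sin \<theta>"
    and "sin (\<theta> + \<psi>) * sin \<psi> + cos (\<theta> + \<psi>) * cos \<psi> = cos \<theta>"
    using sin_diff[of "\<theta> + \<psi>" \<psi>] cos_diff[of "\<theta> + \<psi>" \<psi>] by simp_all
  moreover have "u *\<^sub>R (p *\<^sub>R c + q *\<^sub>R s) + v *\<^sub>R (- (q *\<^sub>R c) + p *\<^sub>R s) =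
      (u * p - v * q) *\<^sub>R c + (u * q + v * p) *\<^sub>R s" for u v p q
    by (simp add: algebra_simps)
  ultimately show ?thesis
    by simp
qed

lemma inner_phase_rotated:
  fixes c s :: "real ^ 'n"
  shows "2 * ((cos \<psi> *\<^sub>R c + sin \<psi> *\<^sub>R s) \<bullet> (- (sin \<psi> *\<^sub>R c) + cos \<psi> *\<^sub>R s)) =
    cos (2 * \<psi>) * (2 * (c \<bullet> s)) - sin (2 * \<psi>) * (sqnorm c - sqnorm s)"
  unfolding sqnorm_def cos_double sin_double
  by (simp add: inner_add_left inner_add_right inner_commute[of s c] algebra_simps power2_eq_square)

lemma sqnorm_diff_phase_rotated:
  fixes c s :: "real ^ 'n"
  shows "sqnorm (cos \<psi> *\<^sub>R c + sin \<psi> *\<^sub>R s) - sqnorm (- (sin \<psi> *\<^sub>R c) + cos \<psi> *\<^sub>R s) =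
    cos (2 * \<psi>) * (sqnorm c - sqnorm s) + sin (2 * \<psi>) * (2 * (c \<bullet> s))"
  unfolding sqnorm_def cos_double sin_double
  by (simp add: inner_add_left inner_add_right inner_commute[of s c] algebra_simps power2_eq_square)

lemma exists_polar_half_angle:
  fixes x y :: real
  obtains \<psi> where "cos (2 * \<psi>) * y = sin (2 * \<psi>) * x" and "cos (2 * \<psi>) * x + sin (2 * \<psi>) * y \<ge> 0"
proof -
  define r where "r = cmod (Complex x y)"
  define \<psi> where "\<psi> = Arg (Complex x y) / 2"
  have "x = r * cos (2 * \<psi>)" and "y = r * sin (2 * \<psi>)"
    using rcis_cmod_Arg[of "Complex x y"] unfolding r_def \<psi>_def
    by (simp_all add: rcis_def complex_eq_iff)
  moreover have "r * cos (2 * \<psi>) * cos (2 * \<psi>) + r * sin (2 * \<psi>) * sin (2 * \<psi>) = r"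
    using sin_cos_squared_add3[of "2 * \<psi>"] by (metis distrib_left mult.assoc mult_1_right)
  moreover have "r \<ge> 0"
    by (simp add: r_def)
  ultimately have "cos (2 * \<psi>) * y = sin (2 * \<psi>) * x"
    and "cos (2 * \<psi>) * x + sin (2 * \<psi>) * y \<ge> 0"
    by (simp_all add: mult_ac)
  then show thesis
    by (rule that)
qed

text \<open>Orthogonality says that \<open>(cos (2\<psi>), sin (2\<psi>))\<close> and \<open>(\<parallel>c\<parallel> - \<parallel>s\<parallel>, 2 \<langle>c, s\<rangle>)\<close> are parallel.
  As the former vector is a unit vector, a nonzero first coordinate of the latter forces
  \<open>cos (2\<psi>) \<noteq> 0\<close>, which makes the division legitimate.\<close>

lemma axis_phase_if_orthogonal:
  assumes "orthogonal (cos \<psi> *\<^sub>R c + sin \<psi> *\<^sub>R s) (- (sin \<psi> *\<^sub>R c) + cos \<psi> *\<^sub>R s)"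
  shows "axis_phase c s \<psi>"
proof -
  have parallel: "cos (2 * \<psi>) * (2 * (c \<bullet> s)) = sin (2 * \<psi>) * (sqnorm c - sqnorm s)"
    using assms inner_phase_rotated[of \<psi> c s] by (simp add: orthogonal_def)
  show ?thesis
  proof (cases "sqnorm c = sqnorm s")
    case True
    with parallel show ?thesis
      by (auto simp: axis_phase_def)
  next
    case False
    have "cos (2 * \<psi>) \<noteq> 0"
    proof
      assume "cos (2 * \<psi>) = 0"
      with parallel False have "sin (2 * \<psi>) = 0"
        by simp
      with \<open>cos (2 * \<psi>) = 0\<close> show False
        using sin_cos_squared_add[of "2 * \<psi>"] by simp
    qed
    with parallel False show ?thesis
      by (simp add: axis_phase_def tan_def field_simps)
  qed
qed

lemma range_sinusoid_eq_ellipse: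
  fixes a b :: "real ^ 'n"
  assumes "\<omega> \<noteq> 0"
  shows "range (\<lambda>t. sin (\<omega> * t + \<psi>) *\<^sub>R a + cos (\<omega> * t + \<psi>) *\<^sub>R b) = ellipse a b"
proof
  show "range (\<lambda>t. sin (\<omega> * t + \<psi>) *\<^sub>R a + cos (\<omega> * t + \<psi>) *\<^sub>R b) \<subseteq> ellipse a b"
    unfolding ellipse_def by (force intro: sin_cos_squared_add)
next
  show "ellipse a b \<subseteq> range (\<lambda>t. sin (\<omega> * t + \<psi>) *\<^sub>R a + cos (\<omega> * t + \<psi>) *\<^sub>R b)"
  proof
    fix v assume "v \<in> ellipse a b"
    then obtain x y where v: "v = x *\<^sub>R a + y *\<^sub>R b" and "y\<^sup>2 + x\<^sup>2 = 1"
      unfolding ellipse_def by (auto simp: add.commute)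
    then obtain \<theta> where "y = cos \<theta>" "x = sin \<theta>"
      using sincos_total_2pi by metis
    then have "v = sin (\<omega> * ((\<theta> - \<psi>) / \<omega>) + \<psi>) *\<^sub>R a + cos (\<omega> * ((\<theta> - \<psi>) / \<omega>) + \<psi>) *\<^sub>R b"
      using v assms by simp
    then show "v \<in> range (\<lambda>t. sin (\<omega> * t + \<psi>) *\<^sub>R a + cos (\<omega> * t + \<psi>) *\<^sub>R b)"
      by (rule range_eqI)
  qed
qed

text \<open>Two times, a quarter period apart, determine both coefficient vectors of a sinusoid.\<close>

lemma sinusoid_coefficients_unique:
  fixes a b c s :: "'a::real_vector"
  assumes "\<omega> \<noteq> 0"
    and eq: "\<And>t. sin (\<omega> * t + \<psi>) *\<^sub>R a + cos (\<omega> * t + \<psi>) *\<^sub>R b = sin (\<omega> * t) *\<^sub>R c + cos (\<omega> * t) *\<^sub>R s"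
  shows "a = cos \<psi> *\<^sub>R c + sin \<psi> *\<^sub>R s" and "b = - (sin \<psi> *\<^sub>R c) + cos \<psi> *\<^sub>R s"
proof -
  have shifted: "sin \<theta> *\<^sub>R a + cos \<theta> *\<^sub>R b = sin (\<theta> - \<psi>) *\<^sub>R c + cos (\<theta> - \<psi>) *\<^sub>R s" for \<theta>
    using eq[of "(\<theta> - \<psi>) / \<omega>"] assms(1) by simp
  show "a = cos \<psi> *\<^sub>R c + sin \<psi> *\<^sub>R s"
    using shifted[of "pi / 2"] by (simp add: sin_diff cos_diff)
  show "b = - (sin \<psi> *\<^sub>R c) + cos \<psi> *\<^sub>R s"
    using shifted[of 0] by simp
qed

theorem theorem2:
  fixes n :: "nat \<Rightarrow> real ^ 'n" and \<phi> :: "nat \<Rightarrow> real"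
    and K :: nat and \<omega> :: real
    and f :: "real \<Rightarrow> real ^ 'n" and c s :: "real ^ 'n"
  assumes "CARD('n) > 1"
    and "\<And>t. f t = (\<Sum>i=1..K. sin (\<omega> * t + \<phi> i) *\<^sub>R n i)"
    and "c = (\<Sum>i=1..K. cos (\<phi> i) *\<^sub>R n i)"
    and "s = (\<Sum>i=1..K. sin (\<phi> i) *\<^sub>R n i)"
  shows "(\<forall>t. f t = sin (\<omega> * t) *\<^sub>R c + cos (\<omega> * t) *\<^sub>R s) \<and>
    (\<exists>a b \<psi>. axis_form \<omega> f a b \<psi> \<and>
       a = cos \<psi> *\<^sub>R c + sin \<psi> *\<^sub>R s \<and>
       b = - (sin \<psi> *\<^sub>R c) + cos \<psi> *\<^sub>R s \<and>
       axis_phase c s \<psi>) \<and>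
    (\<omega> \<noteq> 0 \<longrightarrow> (\<forall>a b \<psi>. axis_form \<omega> f a b \<psi> \<longrightarrow>
       a = cos \<psi> *\<^sub>R c + sin \<psi> *\<^sub>R s \<and>
       b = - (sin \<psi> *\<^sub>R c) + cos \<psi> *\<^sub>R s \<and>
       axis_phase c s \<psi>))"
proof (intro conjI impI allI)
  have f_eq: "f t = sin (\<omega> * t) *\<^sub>R c + cos (\<omega> * t) *\<^sub>R s" for t
    unfolding assms by (rule sum_sinusoids)
  then show "f t = sin (\<omega> * t) *\<^sub>R c + cos (\<omega> * t) *\<^sub>R s" for t .
  show "\<exists>a b \<psi>. axis_form \<omega> f a b \<psi> \<and>
       a = cos \<psi> *\<^sub>R c + sin \<psi> *\<^sub>R s \<and>
       b = - (sin \<psi> *\<^sub>R c) + cos \<psi> *\<^sub>R s \<and>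
       axis_phase c s \<psi>"
  proof -
    obtain \<psi> where parallel: "cos (2 * \<psi>) * (2 * (c \<bullet> s)) = sin (2 * \<psi>) * (sqnorm c - sqnorm s)"
      and nonneg: "cos (2 * \<psi>) * (sqnorm c - sqnorm s) + sin (2 * \<psi>) * (2 * (c \<bullet> s)) \<ge> 0"
      by (rule exists_polar_half_angle)
    define a where "a = cos \<psi> *\<^sub>R c + sin \<psi> *\<^sub>R s"
    define b where "b = - (sin \<psi> *\<^sub>R c) + cos \<psi> *\<^sub>R s"
    have ortho: "orthogonal a b"
      using inner_phase_rotated[of \<psi> c s] parallel by (simp add: orthogonal_def a_def b_def)
    have major: "sqnorm a - sqnorm b \<ge> 0"
      using sqnorm_diff_phase_rotated[of \<psi> c s] nonneg by (simp add: a_def b_def)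
    have f_axes: "f = (\<lambda>t. sin (\<omega> * t + \<psi>) *\<^sub>R a + cos (\<omega> * t + \<psi>) *\<^sub>R b)"
      unfolding a_def b_def sinusoid_phase_shift by (rule ext) (rule f_eq)
    have "axis_form \<omega> f a b \<psi>"
      unfolding axis_form_def using ortho major range_sinusoid_eq_ellipse[of \<omega> \<psi> a b]
      by (simp add: f_axes)
    moreover have "axis_phase c s \<psi>"
      using ortho unfolding a_def b_def by (rule axis_phase_if_orthogonal)
    ultimately show ?thesis
      using a_def b_def by blast
  qed
  fix a b \<psi>
  assume "\<omega> \<noteq> 0" and form: "axis_form \<omega> f a b \<psi>"
  then have "sin (\<omega> * t + \<psi>) *\<^sub>R a + cos (\<omega> * t + \<psi>) *\<^sub>R b = sin (\<omega> * t) *\<^sub>R c + cos (\<omega> * t) *\<^sub>R s" for t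
    using f_eq by (simp add: axis_form_def)
  note coeffs = sinusoid_coefficients_unique[OF \<open>\<omega> \<noteq> 0\<close> this]
  show a: "a = cos \<psi> *\<^sub>R c + sin \<psi> *\<^sub>R s"
    by (rule coeffs)
  show b: "b = - (sin \<psi> *\<^sub>R c) + cos \<psi> *\<^sub>R s"
    by (rule coeffs)
  have "orthogonal a b"
    using form by (simp add: axis_form_def)
  then show "axis_phase c s \<psi>"
    unfolding a b by (rule axis_phase_if_orthogonal)
qed

end
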